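(* The 2-skeleton of the 4-simplex is the face-disjoint union of two triangulated Möbius bands. Furthermore, both of these triangulated Möbius bands are realized geometrically in the Schlegel diagram of the 4-simplex in $\mathbb{R}^3$, which provides a pair of geometric polyhedral Möbius bands in $\mathbb{R}^3$ with the same 1-skeleton but without a single common face.
   Context: The 2-skeleton of the 4-simplex is the simplicial complex formed by all its vertices, edges and triangles. A triangulated Möbius band is a 2-dimensional simplicial complex whose underlying space is homeomorphic to the Möbius band; its faces are its 2-simplices (triangles). A union of two such complexes is face-disjoint if no triangle is a face of both. The Schlegel diagram of the 4-simplex in $\mathbb{R}^3$ is formed by a geometric 3-simplex (tetrahedron) in $\mathbb{R}^3$ stellar subdivided by a fifth vertex chosen arbitrarily in the interior of the tetrahedron. The five vertices of the 4-simplex correspond to the four vertices of the tetrahedron and this interior point, and every edge and triangle of the 4-simplex is represented by the convex hull of the corresponding points. A subcomplex of the 2-skeleton is realized geometrically in the Schlegel diagram if these convex hulls form a polyhedron without self-intersections isomorphic to the subcomplex, i.e. any two of the geometric simplices intersect exactly in the geometric simplex spanned by their common vertices (or are disjoint if they have no common vertex). A geometric polyhedral Möbius band in $\mathbb{R}^3$ is such a geometric realization of a triangulated Möbius band. Its 1-skeleton is its set of vertices and (straight-segment) edges in $\mathbb{R}^3$. *)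

theory Defs
  imports "HOL-Analysis.Analysis"
begin

section \<open>Abstract simplicial complexes\<close>

text \<open>Finite complexes; the empty simplex is not a member.\<close>

definition abstract_complex :: "'v set set \<Rightarrow> bool" where
  "abstract_complex K \<longleftrightarrow> finite K \<and>
     (\<forall>\<sigma>\<in>K. finite \<sigma> \<and> \<sigma> \<noteq> {} \<and> (\<forall>\<tau>. \<tau> \<noteq> {} \<and> \<tau> \<subseteq> \<sigma> \<longrightarrow> \<tau> \<in> K))"

definition full_simplex :: "'v set \<Rightarrow> 'v set set" where
  "full_simplex V = {\<sigma>. \<sigma> \<noteq> {} \<and> \<sigma> \<subseteq> V}"

definition skeleton :: "nat \<Rightarrow> 'v set set \<Rightarrow> 'v set set" where
  "skeleton k K = {\<sigma> \<in> K. card \<sigma> \<le> k + 1}"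

definition triangles :: "'v set set \<Rightarrow> 'v set set" where
  "triangles K = {\<sigma> \<in> K. card \<sigma> = 3}"

definition two_dimensional :: "'v set set \<Rightarrow> bool" where
  "two_dimensional K \<longleftrightarrow> (\<forall>\<sigma>\<in>K. card \<sigma> \<le> 3) \<and> triangles K \<noteq> {}"

text \<open>
  The underlying space is given by barycentric coordinates. Functions carry the product
  topology; for finite complexes its restriction is the usual topology of the realization.
\<close>

definition underlying_space :: "'v set set \<Rightarrow> ('v \<Rightarrow> real) topology" where
  "underlying_space K =
     top_of_set {f. (\<forall>v. 0 \<le> f v) \<and> {v. f v \<noteq> 0} \<in> K \<and> (\<Sum>v | f v \<noteq> 0. f v) = 1}"


section \<open>The Moebius band\<close>

definition quotient_topology :: "'a topology \<Rightarrow> ('a \<times> 'a) set \<Rightarrow> 'a set topology" where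
  "quotient_topology X r = topology (\<lambda>U. U \<subseteq> topspace X // r \<and> openin X (\<Union>U))"

lemma istopology_quotient:
  assumes "equiv (topspace X) r"
  shows "istopology (\<lambda>U. U \<subseteq> topspace X // r \<and> openin X (\<Union>U))"
  unfolding istopology_def
proof (intro conjI allI impI; (elim conjE)?)
  fix S T
  assume S: "S \<subseteq> topspace X // r" "openin X (\<Union>S)" and T: "T \<subseteq> topspace X // r" "openin X (\<Union>T)"
  have "\<Union>(S \<inter> T) = \<Union>S \<inter> \<Union>T"
    using S(1) T(1) quotient_disj[OF assms] by blast
  then show "openin X (\<Union>(S \<inter> T))"
    using S(2) T(2) by auto
  show "S \<inter> T \<subseteq> topspace X // r"
    using S(1) by blast
next
  fix \<K>
  assume K: "\<forall>U\<in>\<K>. U \<subseteq> topspace X // r \<and> openin X (\<Union>U)"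
  then show "\<Union>\<K> \<subseteq> topspace X // r"
    by blast
  have "\<Union>(\<Union>\<K>) = \<Union>(Union ` \<K>)"
    by blast
  then show "openin X (\<Union>(\<Union>\<K>))"
    using K by (metis (mono_tags, lifting) imageE openin_Union)
qed

lemma openin_quotient_topology:
  assumes "equiv (topspace X) r"
  shows "openin (quotient_topology X r) U \<longleftrightarrow> U \<subseteq> topspace X // r \<and> openin X (\<Union>U)"
  unfolding quotient_topology_def
  using topology_inverse'[OF istopology_quotient[OF assms]] by metis

definition unit_square :: "(real \<times> real) set" where
  "unit_square = {0..1} \<times> {0..1}"

text \<open>The left edge is glued to the right edge with reversed direction.\<close>

definition moebius_rel :: "((real \<times> real) \<times> (real \<times> real)) set" where
  "moebius_rel = {(a, b). a \<in> unit_square \<and> b \<in> unit_square \<and>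
     (a = b \<or>
      fst a = 0 \<and> fst b = 1 \<and> snd b = 1 - snd a \<or>
      fst a = 1 \<and> fst b = 0 \<and> snd b = 1 - snd a)}"

lemma equiv_moebius_rel: "equiv unit_square moebius_rel"
  by (intro equivI) (auto simp: moebius_rel_def refl_on_def sym_def trans_def)

definition moebius_band :: "(real \<times> real) set topology" where
  "moebius_band = quotient_topology (top_of_set unit_square) moebius_rel"

lemma openin_moebius_band:
  "openin moebius_band U \<longleftrightarrow>
     U \<subseteq> unit_square // moebius_rel \<and> openin (top_of_set unit_square) (\<Union>U)"
  using openin_quotient_topology[of "top_of_set unit_square" moebius_rel] equiv_moebius_rel
  by (simp add: moebius_band_def)

definition triangulated_moebius_band :: "'v set set \<Rightarrow> bool" where
  "triangulated_moebius_band K \<longleftrightarrow>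
     abstract_complex K \<and> two_dimensional K \<and> underlying_space K homeomorphic_space moebius_band"


section \<open>Geometric realizations\<close>

definition geometric_complex :: "('v \<Rightarrow> real^3) \<Rightarrow> 'v set set \<Rightarrow> (real^3) set set" where
  "geometric_complex p K = (\<lambda>\<sigma>. convex hull (p ` \<sigma>)) ` K"

text \<open>
  Injectivity and affine independence say that each simplex of the complex is represented by
  a nondegenerate geometric simplex. The last condition includes the case of disjoint simplices,
  since \<^term>\<open>convex hull {} = {}\<close>.
\<close>

definition realized_geometrically :: "('v \<Rightarrow> real^3) \<Rightarrow> 'v set set \<Rightarrow> bool" where
  "realized_geometrically p K \<longleftrightarrow>
     inj_on p (\<Union>K) \<and>
     (\<forall>\<sigma>\<in>K. \<not> affine_dependent (p ` \<sigma>)) \<and>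
     (\<forall>\<sigma>\<in>K. \<forall>\<tau>\<in>K.
        convex hull (p ` \<sigma>) \<inter> convex hull (p ` \<tau>) = convex hull (p ` (\<sigma> \<inter> \<tau>)))"

text \<open>As complexes are finite, there is no loss in taking the vertex labels to be naturals.\<close>

definition geometric_moebius_band :: "(real^3) set set \<Rightarrow> bool" where
  "geometric_moebius_band C \<longleftrightarrow>
     (\<exists>(K :: nat set set) p. triangulated_moebius_band K \<and> realized_geometrically p K \<and>
        C = geometric_complex p K)"

definition geometric_1_skeleton :: "(real^3) set set \<Rightarrow> (real^3) set set" where
  "geometric_1_skeleton C = {S \<in> C. aff_dim S \<le> 1}"

definition geometric_faces :: "(real^3) set set \<Rightarrow> (real^3) set set" where
  "geometric_faces C = {S \<in> C. aff_dim S = 2}"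


section \<open>Schlegel diagrams of the 4-simplex\<close>

text \<open>
  A diagram is given by the positions of the five vertices: four of them, in any labelling, are the
  vertices of a tetrahedron and the remaining one is an interior point. Edges and triangles are
  the convex hulls of their vertices.
\<close>

definition schlegel_diagram :: "'v set \<Rightarrow> ('v \<Rightarrow> real^3) \<Rightarrow> bool" where
  "schlegel_diagram V p \<longleftrightarrow>
     card V = 5 \<and>
     (\<exists>v\<in>V. inj_on p (V - {v}) \<and> \<not> affine_dependent (p ` (V - {v})) \<and>
        p v \<in> interior (convex hull (p ` (V - {v}))))"

lemma schlegel_diagram_exists:
  fixes V :: "'v set"
  assumes "card V = 5"
  shows "\<exists>p. schlegel_diagram V p"
proof -
  obtain v where v: "v \<in> V" using assms by fastforce
  have fin: "finite V" using assms card.infinite by fastforce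
  let ?B = "insert 0 Basis :: (real^3) set"
  have indep: "\<not> affine_dependent ?B"
    by (simp add: affine_dependent_iff_dependent independent_Basis)
  have "card ?B = 4" by simp
  moreover have "card (V - {v}) = 4" using assms v by simp
  ultimately obtain f where f: "bij_betw f (V - {v}) ?B"
    using fin by (metis finite_same_card_bij finite_Diff finite_insert finite_Basis)
  obtain a where a: "a \<in> interior (convex hull ?B)"
    using interior_std_simplex_nonempty by blast
  define g where "g = f(v := a)"
  have img: "g ` (V - {v}) = ?B" and inj: "inj_on g (V - {v})"
    using f by (auto simp: g_def bij_betw_def inj_on_def)
  have "g v \<in> interior (convex hull (g ` (V - {v})))"
    unfolding img using a by (simp add: g_def)
  moreover have "\<not> affine_dependent (g ` (V - {v}))"
    unfolding img by (rule indep)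
  ultimately have "schlegel_diagram V g"
    unfolding schlegel_diagram_def using assms v inj by blast
  then show ?thesis by blast
qed

end

theory Submission
  imports Defs
begin

text \<open>
  Number the vertices by residues modulo 5. The first Moebius band has the five triangles
  $\{i, i+1, i+2\}$ and the second the five triangles $\{i, i+2, i+4\}$, which are the images of the
  first five under multiplication by 2. A triangle contains two edges of one of the differences
  $\pm 1$, $\pm 2$ and one edge of the other; the first complex consists of those with two edges of
  difference $\pm 1$, the second of those with two edges of difference $\pm 2$. Hence the ten
  triangles are split evenly, while each complex uses all ten edges
  (\<open>band_complexes_share_edges\<close>, \<open>band_complexes_split_triangles\<close>).
  
  In the first complex the triangles with $i = 0, \dots, 4$ form a strip, each glued to the next along
  the edge $\{i+1, i+2\}$. The strip begins with the edge from 0 to 1 and ends with the edge from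
  $6 \equiv 1$ to $5 \equiv 0$, so that closing it up reverses the direction: this is a Moebius band.
  Concretely, an explicit continuous map sends the unit square onto the complex, and two points have
  the same image only if the defining relation of the Moebius band identifies them
  (\<open>strip_point_eq_iff\<close>, \<open>strip_point_image\<close>); since the square is compact, the quotient is
  homeomorphic to the complex (\<open>homeomorphic_space_quotient_topology\<close>). The second complex is the
  first one with other labels.
  
  In a Schlegel diagram, the interior point is a convex combination of the four other points with
  positive coefficients, and up to a factor this is the only affine dependence among the five points
  (\<open>schlegel_affine_dependence\<close>). If the hulls of two simplices met outside the hull of their common
  vertices, subtracting two expressions of a common point would give a nontrivial dependence, whose
  four coefficients of equal sign would all be at vertices of a single one of the two simplices. A
  triangle has only three vertices; so the whole 2-skeleton is realized geometrically, and with it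
  both bands.
\<close>


section \<open>Realization in Schlegel diagrams\<close>

lemma schlegel_diagram_finite:
  "schlegel_diagram V p \<Longrightarrow> finite V"
  using card.infinite by (fastforce simp: schlegel_diagram_def)

text \<open>
  If $v$ is the interior vertex and $p_v = \sum_w \lambda_w p_w$ with all $\lambda_w > 0$, then
  eliminating $p_v$ from a dependence with coefficients $c$ gives $c_w + c_v \lambda_w = 0$, because
  the other four points are affinely independent. So all $c_w$ have the sign opposite to $c_v$.
\<close>
lemma schlegel_affine_dependence:
  fixes p :: "'v \<Rightarrow> real^3"
  assumes "schlegel_diagram V p"
    and c: "sum c V = 0" "(\<Sum>v\<in>V. c v *\<^sub>R p v) = 0"
  shows "(\<forall>v\<in>V. c v = 0) \<or>
    (\<exists>v\<in>V. (\<forall>w\<in>V - {v}. 0 < c w) \<or> (\<forall>w\<in>V - {v}. c w < 0))"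
proof -
  obtain v where card: "card V = 5" and v: "v \<in> V" and inj: "inj_on p (V - {v})"
    and indep: "\<not> affine_dependent (p ` (V - {v}))"
    and int: "p v \<in> interior (convex hull (p ` (V - {v})))"
    using assms(1) unfolding schlegel_diagram_def by blast
  define W where "W = V - {v}"
  have fin: "finite V" by (rule schlegel_diagram_finite[OF assms(1)])
  then have finW: "finite W" and V: "V = insert v W" "v \<notin> W"
    using v by (auto simp: W_def)
  note inj = inj[folded W_def] and indep = indep[folded W_def] and int = int[folded W_def]
  obtain u where u: "\<forall>x\<in>p ` W. 0 < u x" "sum u (p ` W) = 1" "(\<Sum>x\<in>p ` W. u x *\<^sub>R x) = p v"
    using int interior_convex_hull_explicit_minimal[OF indep] by (auto split: if_splits)
  define l where "l = u \<circ> p"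
  have l: "\<forall>w\<in>W. 0 < l w" "sum l W = 1" "(\<Sum>w\<in>W. l w *\<^sub>R p w) = p v"
    using u inj by (auto simp: l_def sum.reindex)
  define d where "d = (\<lambda>w. c w + c v * l w)"
  have d: "sum d W = 0" "(\<Sum>w\<in>W. d w *\<^sub>R p w) = 0"
  proof -
    have "sum d W = sum c W + c v * sum l W"
      by (simp add: d_def sum.distrib sum_distrib_left)
    also have "\<dots> = sum c V" using V finW l by simp
    finally show "sum d W = 0" using c by simp
    have "(\<Sum>w\<in>W. d w *\<^sub>R p w) = (\<Sum>w\<in>W. c w *\<^sub>R p w) + c v *\<^sub>R (\<Sum>w\<in>W. l w *\<^sub>R p w)"
      by (simp add: d_def sum.distrib scaleR_left_distrib scaleR_sum_right)
    also have "\<dots> = (\<Sum>v\<in>V. c v *\<^sub>R p v)" using V finW l by simp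
    finally show "(\<Sum>w\<in>W. d w *\<^sub>R p w) = 0" using c by simp
  qed
  have d0: "d w = 0" if "w \<in> W" for w
  proof (rule ccontr)
    assume "d w \<noteq> 0"
    moreover have "sum (d \<circ> inv_into W p) (p ` W) = 0"
      "(\<Sum>x\<in>p ` W. (d \<circ> inv_into W p) x *\<^sub>R x) = 0"
      using d inj by (simp_all add: sum.reindex)
    moreover have "(d \<circ> inv_into W p) (p w) = d w"
      using inj that by simp
    ultimately have "affine_dependent (p ` W)"
      unfolding affine_dependent_explicit_finite[OF finite_imageI[OF finW]]
      using that by (intro exI[of _ "d \<circ> inv_into W p"] conjI bexI[of _ "p w"]) auto
    then show False using indep by simp
  qed
  then have cw: "c w = - c v * l w" if "w \<in> W" for w
    using that by (force simp: d_def)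
  consider "c v = 0" | "c v < 0" | "c v > 0" by linarith
  then show ?thesis
  proof cases
    case 1
    then show ?thesis using cw V by auto
  next
    case 2
    then have "\<forall>w\<in>W. 0 < c w" using cw l by (simp add: mult_neg_pos)
    then show ?thesis using v W_def by blast
  next
    case 3
    then have "\<forall>w\<in>W. c w < 0" using cw l by simp
    then show ?thesis using v W_def by blast
  qed
qed

text \<open>
  The form in which the sign pattern is used: four coefficients of equal sign do not fit into a set of
  at most three vertices.
\<close>
lemma schlegel_affine_dependence_trivial:
  fixes p :: "'v \<Rightarrow> real^3"
  assumes S: "schlegel_diagram V p"
    and c: "sum c V = 0" "(\<Sum>v\<in>V. c v *\<^sub>R p v) = 0"
    and \<sigma>: "finite \<sigma>" "card \<sigma> \<le> 3" "\<And>v. v \<in> V \<Longrightarrow> 0 < c v \<Longrightarrow> v \<in> \<sigma>"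
    and \<tau>: "finite \<tau>" "card \<tau> \<le> 3" "\<And>v. v \<in> V \<Longrightarrow> c v < 0 \<Longrightarrow> v \<in> \<tau>"
    and v: "v \<in> V"
  shows "c v = 0"
proof (rule ccontr)
  assume "c v \<noteq> 0"
  then obtain w where w: "w \<in> V" "V - {w} \<subseteq> \<sigma> \<or> V - {w} \<subseteq> \<tau>"
    using schlegel_affine_dependence[OF S c] v \<sigma>(3) \<tau>(3) by blast
  have "card V = 5" using S by (simp add: schlegel_diagram_def)
  then have "card (V - {w}) = 4" using w by simp
  then show False
    using w(2) card_mono[OF \<sigma>(1), of "V - {w}"] card_mono[OF \<tau>(1), of "V - {w}"] \<sigma>(2) \<tau>(2)
    by auto
qed

text \<open>
  If two of the points coincided, their difference would be an affine dependence with only two nonzero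
  coefficients.
\<close>
lemma schlegel_diagram_inj_on:
  fixes p :: "'v \<Rightarrow> real^3"
  assumes S: "schlegel_diagram V p"
  shows "inj_on p V"
proof (rule inj_onI, rule ccontr)
  fix v w assume vw: "v \<in> V" "w \<in> V" "p v = p w" "v \<noteq> w"
  have fin: "finite V"
    by (rule schlegel_diagram_finite[OF S])
  define c :: "'v \<Rightarrow> real" where "c = (\<lambda>x. (if x = v then 1 else 0) - (if x = w then 1 else 0))"
  have "sum c V = 0"
    using vw fin by (simp add: c_def sum_subtractf)
  moreover have "(\<Sum>x\<in>V. c x *\<^sub>R p x) = (\<Sum>x\<in>V. if x = v then p x else 0) - (\<Sum>x\<in>V. if x = w then p x else 0)"
    unfolding sum_subtractf[symmetric] by (rule sum.cong) (auto simp: c_def)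
  then have "(\<Sum>x\<in>V. c x *\<^sub>R p x) = 0"
    using vw fin by simp
  ultimately have "c v = 0"
    by (rule schlegel_affine_dependence_trivial[OF S, where \<sigma> = "{v}" and \<tau> = "{w}"])
      (use vw in \<open>auto simp: c_def split: if_splits\<close>)
  then show False using vw by (simp add: c_def)
qed

text \<open>
  Coefficients are taken on all of $V$ and vanish off $\sigma$, so that expressions over different
  simplices can be subtracted.
\<close>
lemma convex_hull_image_coefficients:
  fixes p :: "'v \<Rightarrow> 'a::real_vector"
  assumes "finite V" "inj_on p V" "\<sigma> \<subseteq> V" "x \<in> convex hull (p ` \<sigma>)"
  obtains a where "\<And>v. 0 \<le> a v" "\<And>v. v \<notin> \<sigma> \<Longrightarrow> a v = 0" "sum a V = 1" "(\<Sum>v\<in>V. a v *\<^sub>R p v) = x"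
proof -
  have fin: "finite \<sigma>" and inj: "inj_on p \<sigma>"
    using assms finite_subset inj_on_subset by blast+
  obtain u where u: "\<forall>y\<in>p ` \<sigma>. 0 \<le> u y" "sum u (p ` \<sigma>) = 1" "(\<Sum>y\<in>p ` \<sigma>. u y *\<^sub>R y) = x"
    using assms(4) unfolding convex_hull_finite[OF finite_imageI[OF fin]] by blast
  define a where "a v = (if v \<in> \<sigma> then u (p v) else 0)" for v
  show thesis
  proof
    show "0 \<le> a v" for v using u by (simp add: a_def)
    show "a v = 0" if "v \<notin> \<sigma>" for v using that by (simp add: a_def)
    have "sum a V = sum a \<sigma>"
      by (rule sum.mono_neutral_right) (use assms in \<open>auto simp: a_def\<close>)
    then show "sum a V = 1" using u inj by (simp add: a_def sum.reindex)
    have "(\<Sum>v\<in>V. a v *\<^sub>R p v) = (\<Sum>v\<in>\<sigma>. a v *\<^sub>R p v)"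
      by (rule sum.mono_neutral_right) (use assms in \<open>auto simp: a_def\<close>)
    then show "(\<Sum>v\<in>V. a v *\<^sub>R p v) = x" using u inj by (simp add: a_def sum.reindex)
  qed
qed

text \<open>
  The difference of the barycentric coordinates of a common point with respect to $\sigma$ and $\tau$
  is an affine dependence that is positive only on $\sigma$ and negative only on $\tau$; it is
  therefore zero, and the common coordinates live on $\sigma \cap \tau$.
\<close>
lemma schlegel_convex_hull_Int:
  fixes p :: "'v \<Rightarrow> real^3"
  assumes S: "schlegel_diagram V p"
    and \<sigma>: "\<sigma> \<subseteq> V" "card \<sigma> \<le> 3" and \<tau>: "\<tau> \<subseteq> V" "card \<tau> \<le> 3"
  shows "convex hull (p ` \<sigma>) \<inter> convex hull (p ` \<tau>) = convex hull (p ` (\<sigma> \<inter> \<tau>))"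
proof
  have fin: "finite V"
    by (rule schlegel_diagram_finite[OF S])
  show "convex hull (p ` \<sigma>) \<inter> convex hull (p ` \<tau>) \<subseteq> convex hull (p ` (\<sigma> \<inter> \<tau>))"
  proof
    fix x assume x: "x \<in> convex hull (p ` \<sigma>) \<inter> convex hull (p ` \<tau>)"
    obtain a where a: "\<And>v. 0 \<le> a v" "\<And>v. v \<notin> \<sigma> \<Longrightarrow> a v = 0" "sum a V = 1"
      "(\<Sum>v\<in>V. a v *\<^sub>R p v) = x"
      using convex_hull_image_coefficients[OF fin schlegel_diagram_inj_on[OF S] \<sigma>(1)] x by blast
    obtain b where b: "\<And>v. 0 \<le> b v" "\<And>v. v \<notin> \<tau> \<Longrightarrow> b v = 0" "sum b V = 1"
      "(\<Sum>v\<in>V. b v *\<^sub>R p v) = x"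
      using convex_hull_image_coefficients[OF fin schlegel_diagram_inj_on[OF S] \<tau>(1)] x by blast
    have ab: "a v = b v" if v: "v \<in> V" for v
    proof -
      have "(\<lambda>v. a v - b v) v = 0"
      proof (rule schlegel_affine_dependence_trivial[OF S])
        show "(\<Sum>v\<in>V. a v - b v) = 0" "(\<Sum>v\<in>V. (a v - b v) *\<^sub>R p v) = 0"
          using a b by (simp_all add: sum_subtractf scaleR_left_diff_distrib)
        show "finite \<sigma>" "finite \<tau>" using \<sigma> \<tau> fin finite_subset by blast+
        show "w \<in> \<sigma>" if "0 < a w - b w" for w
          using that a(2)[of w] b(1)[of w] by fastforce
        show "w \<in> \<tau>" if "a w - b w < 0" for w
          using that b(2)[of w] a(1)[of w] by fastforce
      qed (use \<sigma> \<tau> v in auto)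
      then show ?thesis by simp
    qed
    have supp: "a v = 0" if "v \<in> V - (\<sigma> \<inter> \<tau>)" for v
      using that a(2)[of v] b(2)[of v] ab[of v] by auto
    have "sum a (\<sigma> \<inter> \<tau>) = sum a V"
      by (rule sum.mono_neutral_left) (use \<sigma> fin supp in auto)
    then have one: "sum a (\<sigma> \<inter> \<tau>) = 1" using a by simp
    have "(\<Sum>v\<in>\<sigma> \<inter> \<tau>. a v *\<^sub>R p v) = (\<Sum>v\<in>V. a v *\<^sub>R p v)"
      by (rule sum.mono_neutral_left) (use \<sigma> fin supp in auto)
    then have "x = (\<Sum>v\<in>\<sigma> \<inter> \<tau>. a v *\<^sub>R p v)" using a by simp
    also have "\<dots> \<in> convex hull (p ` (\<sigma> \<inter> \<tau>))"
      by (rule convex_sum) (use one a(1) finite_subset[OF \<sigma>(1) fin] in \<open>auto simp: hull_inc\<close>)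
    finally show "x \<in> convex hull (p ` (\<sigma> \<inter> \<tau>))" .
  qed
qed (simp add: hull_mono image_mono)

lemma schlegel_affine_independent:
  fixes p :: "'v \<Rightarrow> real^3"
  assumes S: "schlegel_diagram V p" and \<sigma>: "\<sigma> \<subseteq> V" "card \<sigma> \<le> 3"
  shows "\<not> affine_dependent (p ` \<sigma>)"
proof
  assume "affine_dependent (p ` \<sigma>)"
  have fin: "finite V"
    by (rule schlegel_diagram_finite[OF S])
  then have fin\<sigma>: "finite \<sigma>" using \<sigma> finite_subset by blast
  have inj: "inj_on p \<sigma>" using schlegel_diagram_inj_on[OF S] \<sigma>(1) inj_on_subset by blast
  obtain u w where u: "sum u (p ` \<sigma>) = 0" "(\<Sum>x\<in>p ` \<sigma>. u x *\<^sub>R x) = 0"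
    and w: "w \<in> \<sigma>" "u (p w) \<noteq> 0"
    using \<open>affine_dependent (p ` \<sigma>)\<close>
    unfolding affine_dependent_explicit_finite[OF finite_imageI[OF fin\<sigma>]] by blast
  define c where "c v = (if v \<in> \<sigma> then u (p v) else 0)" for v
  have "sum c V = sum c \<sigma>"
    by (rule sum.mono_neutral_right) (use \<sigma> fin in \<open>auto simp: c_def\<close>)
  then have c1: "sum c V = 0" using u inj by (simp add: c_def sum.reindex)
  have "(\<Sum>v\<in>V. c v *\<^sub>R p v) = (\<Sum>v\<in>\<sigma>. c v *\<^sub>R p v)"
    by (rule sum.mono_neutral_right) (use \<sigma> fin in \<open>auto simp: c_def\<close>)
  then have c2: "(\<Sum>v\<in>V. c v *\<^sub>R p v) = 0" using u inj by (simp add: c_def sum.reindex)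
  have "c w = 0"
    using c1 c2
    by (rule schlegel_affine_dependence_trivial[OF S, where \<sigma> = \<sigma> and \<tau> = \<sigma>])
      (use \<sigma> fin\<sigma> w(1) in \<open>auto simp: c_def split: if_splits\<close>)
  then show False using w by (simp add: c_def)
qed

lemma schlegel_diagram_realizes_2_skeleton:
  fixes p :: "'v \<Rightarrow> real^3"
  assumes S: "schlegel_diagram V p" and K: "K \<subseteq> skeleton 2 (full_simplex V)"
  shows "realized_geometrically p K"
proof -
  have *: "\<sigma> \<subseteq> V" "card \<sigma> \<le> 3" if "\<sigma> \<in> K" for \<sigma>
    using K that by (auto simp: skeleton_def full_simplex_def)
  have "inj_on p (\<Union>K)"
    using * by (intro inj_on_subset[OF schlegel_diagram_inj_on[OF S]]) blast
  then show ?thesis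
    unfolding realized_geometrically_def
    using schlegel_affine_independent[OF S] schlegel_convex_hull_Int[OF S] * by auto
qed

lemma schlegel_aff_dim:
  fixes p :: "'v \<Rightarrow> real^3"
  assumes S: "schlegel_diagram V p" and \<sigma>: "\<sigma> \<subseteq> V" "card \<sigma> \<le> 3"
  shows "aff_dim (convex hull (p ` \<sigma>)) = int (card \<sigma>) - 1"
  using schlegel_affine_independent[OF S \<sigma>] inj_on_subset[OF schlegel_diagram_inj_on[OF S] \<sigma>(1)]
  by (simp add: aff_dim_convex_hull affine_independent_iff_card card_image)

text \<open>
  As the simplices are nondegenerate, affine dimension of the hulls is combinatorial dimension. Both
  this lemma and the next one move geometric statements to the abstract complexes.
\<close>
lemma schlegel_geometric_1_skeleton:
  fixes p :: "'v \<Rightarrow> real^3"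
  assumes S: "schlegel_diagram V p" and K: "K \<subseteq> skeleton 2 (full_simplex V)"
  shows "geometric_1_skeleton (geometric_complex p K) = geometric_complex p (skeleton 1 K)"
proof -
  have "aff_dim (convex hull (p ` \<sigma>)) \<le> 1 \<longleftrightarrow> card \<sigma> \<le> 1 + 1" if "\<sigma> \<in> K" for \<sigma>
    using schlegel_aff_dim[OF S, of \<sigma>] K that by (auto simp: skeleton_def full_simplex_def)
  then show ?thesis
    by (auto simp: geometric_1_skeleton_def geometric_complex_def skeleton_def)
qed

lemma schlegel_geometric_faces:
  fixes p :: "'v \<Rightarrow> real^3"
  assumes S: "schlegel_diagram V p" and K: "K \<subseteq> skeleton 2 (full_simplex V)"
  shows "geometric_faces (geometric_complex p K) = geometric_complex p (triangles K)"
proof -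
  have "aff_dim (convex hull (p ` \<sigma>)) = 2 \<longleftrightarrow> card \<sigma> = 3" if "\<sigma> \<in> K" for \<sigma>
    using schlegel_aff_dim[OF S, of \<sigma>] K that by (auto simp: skeleton_def full_simplex_def)
  then show ?thesis
    by (auto simp: geometric_faces_def geometric_complex_def triangles_def)
qed

text \<open>
  Two simplices with the same hull share it with their common face; comparing affine dimensions shows
  that this face is all of either simplex. It follows that complexes without common triangles have
  no common geometric faces.
\<close>
lemma schlegel_convex_hull_inj_on:
  fixes p :: "'v \<Rightarrow> real^3"
  assumes S: "schlegel_diagram V p"
  shows "inj_on (\<lambda>\<sigma>. convex hull (p ` \<sigma>)) (skeleton 2 (full_simplex V))"
proof (rule inj_onI)
  fix \<sigma> \<tau>
  assume "\<sigma> \<in> skeleton 2 (full_simplex V)" "\<tau> \<in> skeleton 2 (full_simplex V)"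
    and eq: "convex hull (p ` \<sigma>) = convex hull (p ` \<tau>)"
  then have \<sigma>: "\<sigma> \<subseteq> V" "card \<sigma> \<le> 3" and \<tau>: "\<tau> \<subseteq> V" "card \<tau> \<le> 3"
    by (auto simp: skeleton_def full_simplex_def)
  have fin: "finite \<sigma>" "finite \<tau>"
    using schlegel_diagram_finite[OF S] \<sigma>(1) \<tau>(1) finite_subset by auto
  have int: "\<sigma> \<inter> \<tau> \<subseteq> V" "card (\<sigma> \<inter> \<tau>) \<le> 3"
    using \<sigma> card_mono[OF fin(1), of "\<sigma> \<inter> \<tau>"] by auto
  have "convex hull (p ` \<sigma>) = convex hull (p ` (\<sigma> \<inter> \<tau>))"
    using schlegel_convex_hull_Int[OF S \<sigma> \<tau>] eq by simp
  then have "card (\<sigma> \<inter> \<tau>) = card \<sigma>" "card (\<sigma> \<inter> \<tau>) = card \<tau>"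
    using eq schlegel_aff_dim[OF S \<sigma>] schlegel_aff_dim[OF S \<tau>] schlegel_aff_dim[OF S int] by auto
  then show "\<sigma> = \<tau>"
    using fin by (metis card_subset_eq inf_le1 inf_le2)
qed

section \<open>Quotients of compact spaces and relabelled complexes\<close>

text \<open>
  A continuous surjection from a compact space to a Hausdorff space is a quotient map. If its fibres
  are the classes of $r$, it factors through the quotient by an injective map, which is again a
  quotient map and thus a homeomorphism.
\<close>
lemma homeomorphic_space_quotient_topology:
  assumes r: "equiv (topspace X) r" and "compact_space X" "Hausdorff_space Y"
    and g: "continuous_map X Y g" "g ` topspace X = topspace Y"
    and fibres: "\<And>x y. x \<in> topspace X \<Longrightarrow> y \<in> topspace X \<Longrightarrow> g x = g y \<longleftrightarrow> (x, y) \<in> r"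
  shows "quotient_topology X r homeomorphic_space Y"
proof -
  let ?Q = "quotient_topology X r" and ?q = "\<lambda>x. r `` {x}"
  note openin_Q = openin_quotient_topology[OF r]
  \<comment> \<open>The open sets of the quotient are given by unions of classes; these are preimages under the
    projection.\<close>
  have preimage: "{x \<in> topspace X. ?q x \<in> U} = \<Union>U" if "U \<subseteq> topspace X // r" for U
  proof -
    have "?q x \<in> U" if "x \<in> C" "C \<in> U" for x C
      using that \<open>U \<subseteq> topspace X // r\<close> quotientI r
      by (metis Image_singleton_iff equiv_class_eq quotientE subsetD)
    moreover have "x \<in> ?q x" if "x \<in> topspace X" for x
      using equiv_class_self[OF r that] .
    moreover have "\<Union>U \<subseteq> topspace X"
      using that Union_quotient[OF r] by blast
    ultimately show ?thesis by blast
  qed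
  have top: "topspace ?Q = topspace X // r"
  proof
    show "topspace ?Q \<subseteq> topspace X // r" using openin_Q[of "topspace ?Q"] by simp
    have "openin ?Q (topspace X // r)" unfolding openin_Q by (simp add: Union_quotient[OF r])
    then show "topspace X // r \<subseteq> topspace ?Q" by (rule openin_subset)
  qed
  have q: "quotient_map X ?Q ?q"
    unfolding quotient_map_def top using preimage openin_Q
    by (auto simp: quotient_def)
  obtain h where h: "continuous_map ?Q Y h" and hq: "\<And>x. x \<in> topspace X \<Longrightarrow> h (?q x) = g x"
    using quotient_map_lift_exists[OF q g(1)] fibres eq_equiv_class_iff[OF r] by metis
  have "quotient_map X Y g"
    using assms by (intro continuous_imp_quotient_map) auto
  then have "quotient_map X Y (h \<circ> ?q)"
    by (rule quotient_map_eq) (simp add: hq)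
  then have "quotient_map ?Q Y h"
    using quotient_map_from_composition q h quotient_imp_continuous_map by blast
  moreover have "inj_on h (topspace ?Q)"
  proof (rule inj_onI)
    fix C D assume "C \<in> topspace ?Q" "D \<in> topspace ?Q" "h C = h D"
    then obtain x y where "x \<in> topspace X" "y \<in> topspace X" "C = ?q x" "D = ?q y"
      unfolding top quotient_def by blast
    then show "C = D" using \<open>h C = h D\<close> hq fibres equiv_class_eq[OF r] by metis
  qed
  ultimately show ?thesis
    using homeomorphic_map_imp_homeomorphic_space homeomorphic_map_def by blast
qed

text \<open>
  Composition with $\pi$ permutes the coordinates of the space of all functions, so it is continuous
  with continuous inverse.
\<close>
lemma underlying_space_relabel:
  fixes K :: "'v set set" and \<pi> :: "'v \<Rightarrow> 'v"
  assumes \<pi>: "bij \<pi>"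
  shows "underlying_space ((`) \<pi> ` K) homeomorphic_space underlying_space K"
proof -
  define points where
    "points K = {f. (\<forall>v. 0 \<le> f v) \<and> {v. f v \<noteq> 0} \<in> K \<and> (\<Sum>v | f v \<noteq> 0. f v) = (1::real)}"
    for K :: "'v set set"
  have "continuous_on S (\<lambda>f. f \<circ> \<rho>)" for S :: "('v \<Rightarrow> real) set" and \<rho> :: "'v \<Rightarrow> 'v"
    by (intro continuous_on_coordinatewise_then_product)
      (simp add: continuous_on_subset[OF continuous_on_product_coordinates])
  moreover have pull: "f \<circ> \<rho> \<in> points L" if "bij \<rho>" and f: "f \<in> points ((`) \<rho> ` L)"
    for f \<rho> and L :: "'v set set"
  proof -
    have bb: "bij_betw \<rho> {v. f (\<rho> v) \<noteq> 0} {v. f v \<noteq> 0}"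
      using \<open>bij \<rho>\<close> unfolding bij_betw_def bij_def by (force simp: inj_on_def)
    from f obtain \<sigma> where \<sigma>: "\<sigma> \<in> L" "{v. f v \<noteq> 0} = \<rho> ` \<sigma>"
      by (auto simp: points_def)
    then have "{v. f (\<rho> v) \<noteq> 0} = \<sigma>"
      using bb \<open>bij \<rho>\<close> by (metis bij_betw_imp_surj_on bij_is_inj inj_image_eq_iff)
    then show ?thesis
      using f \<sigma>(1) sum.reindex_bij_betw[OF bb, of f] by (auto simp: points_def)
  qed
  moreover have "(`) (inv \<pi>) ` (`) \<pi> ` K = K"
    using \<pi> by (simp add: image_image bij_is_inj inv_f_f)
  ultimately have "homeomorphic_maps (underlying_space ((`) \<pi> ` K)) (underlying_space K)
      (\<lambda>f. f \<circ> \<pi>) (\<lambda>f. f \<circ> inv \<pi>)"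
    using \<pi> pull[of "inv \<pi>" _ "(`) \<pi> ` K"] bij_imp_bij_inv[OF \<pi>]
    unfolding homeomorphic_maps_def underlying_space_def points_def[symmetric]
    by (auto simp: comp_assoc bij_is_inj bij_is_surj surj_iff[THEN iffD1] simp del: o_apply)
  then show ?thesis by (auto simp: homeomorphic_space_def)
qed

text \<open>
  Describes a union of simplices by closed conditions on the coordinates of each facet, without the
  exact support that occurs in the definition of the underlying space.
\<close>
lemma topspace_underlying_space_full_simplices:
  assumes "\<And>i. i \<in> I \<Longrightarrow> finite (T i)"
  shows "topspace (underlying_space (\<Union>i\<in>I. full_simplex (T i))) =
    (\<Union>i\<in>I. {f. (\<forall>v. 0 \<le> f v) \<and> (\<forall>v. v \<notin> T i \<longrightarrow> f v = 0) \<and> sum f (T i) = 1})"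
proof -
  have "{v. f v \<noteq> 0} \<in> full_simplex (T i) \<and> (\<Sum>v | f v \<noteq> 0. f v) = 1 \<longleftrightarrow>
      (\<forall>v. v \<notin> T i \<longrightarrow> f v = 0) \<and> sum f (T i) = 1"
    if "i \<in> I" for i and f :: "'b \<Rightarrow> real"
  proof (cases "\<forall>v. v \<notin> T i \<longrightarrow> f v = 0")
    case True
    then have "(\<Sum>v | f v \<noteq> 0. f v) = sum f (T i)"
      by (intro sum.mono_neutral_left assms that) auto
    moreover have "{v. f v \<noteq> 0} \<noteq> {}" if "sum f (T i) = 1"
      using that by (auto intro: ccontr)
    ultimately show ?thesis
      using True by (auto simp: full_simplex_def)
  qed (auto simp: full_simplex_def)
  then show ?thesis
    by (auto simp: underlying_space_def)
qed

section \<open>The two complexes\<close>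

definition band_complex :: "nat \<Rightarrow> nat set set" where
  "band_complex d = (\<Union>i<5. full_simplex {i, (i + d) mod 5, (i + 2 * d) mod 5})"

lemma lessThan_5: "{..<5} = {0, 1, 2, 3, 4 :: nat}"
  by auto

lemma atMost_4: "{0..4} = {0, 1, 2, 3, 4 :: nat}"
  by auto

lemma band_complex_1:
  "band_complex 1 = full_simplex {0, 1, 2} \<union> full_simplex {1, 2, 3} \<union> full_simplex {2, 3, 4} \<union>
     full_simplex {3, 4, 0} \<union> full_simplex {4, 0, 1}"
  by (simp add: band_complex_def lessThan_5 Un_ac) (simp add: numeral_2_eq_2)

lemma band_complex_2:
  "band_complex 2 = full_simplex {0, 2, 4} \<union> full_simplex {1, 3, 0} \<union> full_simplex {2, 4, 1} \<union>
     full_simplex {3, 0, 2} \<union> full_simplex {4, 1, 3}"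
  by (simp add: band_complex_def lessThan_5 Un_ac) (simp add: numeral_2_eq_2)

lemma full_simplex_image:
  fixes f :: "'a \<Rightarrow> 'c"
  shows "(`) f ` full_simplex V = full_simplex (f ` V)"
proof -
  have Pow: "full_simplex V = Pow V - {{}}" for V :: "'c set"
    by (auto simp: full_simplex_def)
  have "full_simplex V = Pow V - {{}}" for V :: "'a set"
    by (auto simp: full_simplex_def)
  moreover have "(`) f ` (Pow V - {{}}) = (`) f ` Pow V - {{}}"
    by auto
  ultimately show ?thesis
    using image_Pow_surj[OF refl, of f V] by (simp add: Pow)
qed

text \<open>
  Multiplication by 2 on the residues modulo 5, extended by the identity since a relabelling has to be
  a permutation of all naturals.
\<close>
definition double_mod_5 :: "nat \<Rightarrow> nat" where
  "double_mod_5 v = (if v < 5 then 2 * v mod 5 else v)"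

lemma bij_double_mod_5: "bij double_mod_5"
proof (rule o_bij)
  \<comment> \<open>The inverse of 2 modulo 5 is 3.\<close>
  let ?h = "\<lambda>v. if v < 5 then 3 * v mod 5 else v :: nat"
  have "6 * v mod 5 = v" if "v < 5" for v :: nat
  proof -
    have "6 * v = v + 5 * v" by simp
    then show ?thesis using that by (simp only: mod_mult_self2 mod_less)
  qed
  then show "?h \<circ> double_mod_5 = id" "double_mod_5 \<circ> ?h = id"
    by (simp_all add: fun_eq_iff double_mod_5_def mod_mult_right_eq)
qed

lemma double_mod_5_band_complex: "(`) double_mod_5 ` band_complex 1 = band_complex 2"
  unfolding band_complex_1 band_complex_2 image_Un full_simplex_image
  by (auto simp: double_mod_5_def insert_commute)

lemma abstract_complex_full_simplices:
  assumes "finite I" "\<And>i. i \<in> I \<Longrightarrow> finite (T i)"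
  shows "abstract_complex (\<Union>i\<in>I. full_simplex (T i))"
  unfolding abstract_complex_def
proof (intro conjI ballI allI impI)
  have "finite (full_simplex (T i))" if "i \<in> I" for i
    using assms(2)[OF that] by (rule finite_subset[rotated, OF finite_Pow_iff[THEN iffD2]])
      (auto simp: full_simplex_def)
  with assms(1) show "finite (\<Union>i\<in>I. full_simplex (T i))" by blast
next
  fix \<sigma> assume "\<sigma> \<in> (\<Union>i\<in>I. full_simplex (T i))"
  then obtain i where i: "i \<in> I" "\<sigma> \<noteq> {}" "\<sigma> \<subseteq> T i"
    by (auto simp: full_simplex_def)
  then show "finite \<sigma>" "\<sigma> \<noteq> {}"
    using assms(2) finite_subset by blast+
  fix \<tau> assume "\<tau> \<noteq> {} \<and> \<tau> \<subseteq> \<sigma>"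
  then have "\<tau> \<in> full_simplex (T i)"
    using i(3) by (auto simp: full_simplex_def)
  with i(1) show "\<tau> \<in> (\<Union>i\<in>I. full_simplex (T i))" by blast
qed

lemma abstract_band_complex: "abstract_complex (band_complex d)"
  unfolding band_complex_def by (rule abstract_complex_full_simplices) auto

lemma band_complex_subset_skeleton:
  "band_complex d \<subseteq> skeleton 2 (full_simplex {0..4})"
proof
  fix \<sigma> assume \<sigma>: "\<sigma> \<in> band_complex d"
  then obtain i where i: "i < 5" "\<sigma> \<noteq> {}" "\<sigma> \<subseteq> {i, (i + d) mod 5, (i + 2 * d) mod 5}"
    by (auto simp: band_complex_def full_simplex_def)
  then have "card \<sigma> \<le> card {i, (i + d) mod 5, (i + 2 * d) mod 5}"
    by (intro card_mono) auto
  also have "\<dots> \<le> 3"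
    by (simp add: card_insert_if)
  finally have "card \<sigma> \<le> 3" .
  moreover have "v mod 5 \<le> 4" for v :: nat
    using mod_less_divisor[of 5 v] by linarith
  then have "{i, (i + d) mod 5, (i + 2 * d) mod 5} \<subseteq> {0..4}"
    using i(1) by auto
  ultimately show "\<sigma> \<in> skeleton 2 (full_simplex {0..4})"
    using i by (auto simp: skeleton_def full_simplex_def)
qed

lemma two_dimensional_band_complex:
  "two_dimensional (band_complex 1)" "two_dimensional (band_complex 2)"
proof -
  have *: "\<forall>\<sigma>\<in>band_complex d. card \<sigma> \<le> 3" for d
    using band_complex_subset_skeleton[of d] by (auto simp: skeleton_def)
  have "{0, 1, 2} \<in> triangles (band_complex 1)"
    unfolding triangles_def band_complex_1 full_simplex_def by simp
  then show "two_dimensional (band_complex 1)"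
    using * by (auto simp: two_dimensional_def)
  have "{0, 2, 4} \<in> triangles (band_complex 2)"
    unfolding triangles_def band_complex_2 full_simplex_def by simp
  then show "two_dimensional (band_complex 2)"
    using * by (auto simp: two_dimensional_def)
qed

text \<open>
  The edge $\{j, j + e\}$ with $e \in \{1, 2\}$ lies in the triangle $\{j, j+1, j+2\}$ of the first
  complex. Multiplication by 2 permutes the edges, so the second complex contains all of them as well.
  The finitely many simplices are simply enumerated below.
\<close>
lemma band_complexes_share_edges:
  assumes "\<sigma> \<in> full_simplex {0..4}" "card \<sigma> \<le> 2"
  shows "\<sigma> \<in> band_complex 1" "\<sigma> \<in> band_complex 2"
proof -
  have "\<forall>\<sigma>\<in>Pow {0, 1, 2, 3, 4 :: nat}. \<sigma> \<noteq> {} \<longrightarrow> card \<sigma> \<le> 2 \<longrightarrow>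
      \<sigma> \<in> band_complex 1 \<and> \<sigma> \<in> band_complex 2"
    unfolding band_complex_1 band_complex_2
    by (simp add: Pow_insert full_simplex_def)
  with assms show "\<sigma> \<in> band_complex 1" "\<sigma> \<in> band_complex 2"
    by (auto simp: full_simplex_def atMost_4)
qed

lemma band_complexes_split_triangles:
  assumes "\<sigma> \<in> full_simplex {0..4}" "card \<sigma> = 3"
  shows "\<sigma> \<in> band_complex 1 \<longleftrightarrow> \<sigma> \<notin> band_complex 2"
proof -
  have "\<forall>\<sigma>\<in>Pow {0, 1, 2, 3, 4 :: nat}. card \<sigma> = 3 \<longrightarrow>
      (\<sigma> \<in> band_complex 1 \<longleftrightarrow> \<sigma> \<notin> band_complex 2)"
    unfolding band_complex_1 band_complex_2
    by (simp add: Pow_insert full_simplex_def)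
  with assms show ?thesis
    by (auto simp: full_simplex_def atMost_4)
qed

section \<open>The underlying space is a Moebius band\<close>

text \<open>
  The point whose barycentric coordinates at the five vertices are the arguments.
\<close>
definition weights :: "real \<Rightarrow> real \<Rightarrow> real \<Rightarrow> real \<Rightarrow> real \<Rightarrow> nat \<Rightarrow> real" where
  "weights a b c d e = (\<lambda>_. 0)(0 := a, 1 := b, 2 := c, 3 := d, 4 := e)"

lemma weights_eq_iff:
  "weights a b c d e = weights a' b' c' d' e' \<longleftrightarrow> a = a' \<and> b = b' \<and> c = c' \<and> d = d' \<and> e = e'"
proof
  assume eq: "weights a b c d e = weights a' b' c' d' e'"
  show "a = a' \<and> b = b' \<and> c = c' \<and> d = d' \<and> e = e'"
    using fun_cong[OF eq, of 0] fun_cong[OF eq, of 1] fun_cong[OF eq, of 2]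
      fun_cong[OF eq, of 3] fun_cong[OF eq, of 4]
    by (simp add: weights_def)
qed simp

lemma supported_on_band_triangle:
  "\<forall>v. v \<notin> {0, 1, 2} \<longrightarrow> f v = 0 \<Longrightarrow> weights (f 0) (f 1) (f 2) 0 0 = f"
  "\<forall>v. v \<notin> {1, 2, 3} \<longrightarrow> f v = 0 \<Longrightarrow> weights 0 (f 1) (f 2) (f 3) 0 = f"
  "\<forall>v. v \<notin> {2, 3, 4} \<longrightarrow> f v = 0 \<Longrightarrow> weights 0 0 (f 2) (f 3) (f 4) = f"
  "\<forall>v. v \<notin> {3, 4, 0} \<longrightarrow> f v = 0 \<Longrightarrow> weights (f 0) 0 0 (f 3) (f 4) = f"
  "\<forall>v. v \<notin> {4, 0, 1} \<longrightarrow> f v = 0 \<Longrightarrow> weights (f 0) (f 1) 0 0 (f 4) = f"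
  by (auto simp: weights_def fun_eq_iff)

text \<open>
  The coordinates are listed so that $a$, $b$, $c$ belong to the first, second and third vertex of a
  triangle in its order along the strip. For example, the fourth triangle has the vertices 3, 4,
  $5 \equiv 0$, and its third coordinate is the one at vertex 0.
\<close>
definition band_points :: "(nat \<Rightarrow> real) set" where
  "band_points = {f. \<exists>a b c. 0 \<le> a \<and> 0 \<le> b \<and> 0 \<le> c \<and> a + b + c = 1 \<and>
     f \<in> {weights a b c 0 0, weights 0 a b c 0, weights 0 0 a b c,
          weights c 0 0 a b, weights b c 0 0 a}}"

lemma band_points_weights:
  assumes "0 \<le> a" "0 \<le> b" "0 \<le> c" "a + b + c = 1"
  shows "weights a b c 0 0 \<in> band_points" "weights 0 a b c 0 \<in> band_points"
    "weights 0 0 a b c \<in> band_points" "weights c 0 0 a b \<in> band_points"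
    "weights b c 0 0 a \<in> band_points"
  using assms unfolding band_points_def by blast+

lemma underlying_space_band_complex_1:
  "underlying_space (band_complex 1) = top_of_set band_points"
proof -
  define D where
    "D T = {f. (\<forall>v. 0 \<le> f v) \<and> (\<forall>v. v \<notin> T \<longrightarrow> f v = 0) \<and> sum f T = (1::real)}" for T :: "nat set"
  have "topspace (underlying_space (band_complex 1)) =
      D {0, 1, 2} \<union> D {1, 2, 3} \<union> D {2, 3, 4} \<union> D {3, 4, 0} \<union> D {4, 0, 1}"
    unfolding band_complex_def D_def
    by (subst topspace_underlying_space_full_simplices, simp_all add: lessThan_5 Un_ac)
      (simp add: numeral_2_eq_2)
  also have "\<dots> = band_points"
  proof (intro equalityI subsetI)
    fix f assume "f \<in> D {0, 1, 2} \<union> D {1, 2, 3} \<union> D {2, 3, 4} \<union> D {3, 4, 0} \<union> D {4, 0, 1}"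
    then show "f \<in> band_points"
      unfolding Un_iff
    proof (elim disjE)
      assume "f \<in> D {0, 1, 2}"
      then show ?thesis
        using supported_on_band_triangle(1)[of f] band_points_weights(1)[of "f 0" "f 1" "f 2"]
        by (auto simp: D_def)
    next
      assume "f \<in> D {1, 2, 3}"
      then show ?thesis
        using supported_on_band_triangle(2)[of f] band_points_weights(2)[of "f 1" "f 2" "f 3"]
        by (auto simp: D_def)
    next
      assume "f \<in> D {2, 3, 4}"
      then show ?thesis
        using supported_on_band_triangle(3)[of f] band_points_weights(3)[of "f 2" "f 3" "f 4"]
        by (auto simp: D_def)
    next
      assume "f \<in> D {3, 4, 0}"
      then show ?thesis
        using supported_on_band_triangle(4)[of f] band_points_weights(4)[of "f 3" "f 4" "f 0"]
        by (auto simp: D_def)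
    next
      assume "f \<in> D {4, 0, 1}"
      then show ?thesis
        using supported_on_band_triangle(5)[of f] band_points_weights(5)[of "f 4" "f 0" "f 1"]
        by (auto simp: D_def)
    qed
  next
    fix f assume "f \<in> band_points"
    then obtain a b c where abc: "0 \<le> a" "0 \<le> b" "0 \<le> c" "a + b + c = 1"
      and f: "f \<in> {weights a b c 0 0, weights 0 a b c 0, weights 0 0 a b c,
            weights c 0 0 a b, weights b c 0 0 a}"
      by (auto simp: band_points_def)
    have "weights a b c 0 0 \<in> D {0, 1, 2}" "weights 0 a b c 0 \<in> D {1, 2, 3}"
      "weights 0 0 a b c \<in> D {2, 3, 4}" "weights c 0 0 a b \<in> D {3, 4, 0}"
      "weights b c 0 0 a \<in> D {4, 0, 1}"
      using abc by (simp_all add: D_def weights_def)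
    then show "f \<in> D {0, 1, 2} \<union> D {1, 2, 3} \<union> D {2, 3, 4} \<union> D {3, 4, 0} \<union> D {4, 0, 1}"
      using f by blast
  qed
  finally show ?thesis
    unfolding underlying_space_def by simp
qed

text \<open>
  The amount, between 0 and $w$, that has been moved by time $s$ when a supply $w$ starts to move at
  time $t$ at unit speed.
\<close>
definition flow :: "real \<Rightarrow> real \<Rightarrow> real \<Rightarrow> real" where
  "flow w t s = max 0 (min w (s - t))"

text \<open>
  The strip is a trapezoid of height 1: its lower side consists of three unit edges with the vertices
  0, 2, 4, $6 \equiv 1$ and its upper side of two unit edges with the vertices 1, 3, $5 \equiv 0$. At
  height $y$ a triangle standing on the lower side has width $1 - y$ and one hanging from the upper
  side has width $y$, so the horizontal line at height $y$ has length $3 - y$ and meets the sides of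
  the triangles at the positions $0, 1 - y, 1, 2 - y, 2, 3 - y$. The point at position $s$ starts with
  weight $1 - y$ at vertex 0 and $y$ at vertex 1; while it crosses triangle $i$, the weight at vertex
  $i$ flows to vertex $i + 2$ and vertex $i + 1$ keeps its weight. Summing up these flows gives one
  formula for the whole strip, from which continuity is evident.
\<close>
definition strip_point :: "real \<Rightarrow> real \<Rightarrow> nat \<Rightarrow> real" where
  "strip_point s y = weights
     (1 - y - flow (1 - y) 0 s + flow y (2 - y) s)
     (y - flow y (1 - y) s + flow (1 - y) 2 s)
     (flow (1 - y) 0 s - flow (1 - y) 1 s)
     (flow y (1 - y) s - flow y (2 - y) s)
     (flow (1 - y) 1 s - flow (1 - y) 2 s)"

lemma strip_point_cell:
  assumes "0 \<le> y" "y \<le> 1"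
  shows
    "0 \<le> s \<Longrightarrow> s \<le> 1 - y \<Longrightarrow> strip_point s y = weights (1 - y - s) y s 0 0"
    "1 - y \<le> s \<Longrightarrow> s \<le> 1 \<Longrightarrow> strip_point s y = weights 0 (1 - s) (1 - y) (s - (1 - y)) 0"
    "1 \<le> s \<Longrightarrow> s \<le> 2 - y \<Longrightarrow> strip_point s y = weights 0 0 (2 - y - s) y (s - 1)"
    "2 - y \<le> s \<Longrightarrow> s \<le> 2 \<Longrightarrow> strip_point s y = weights (s - (2 - y)) 0 0 (2 - s) (1 - y)"
    "2 \<le> s \<Longrightarrow> s \<le> 3 - y \<Longrightarrow> strip_point s y = weights y (s - 2) 0 0 (3 - y - s)"
  using assms by (auto simp: strip_point_def flow_def weights_eq_iff)

lemma strip_cases: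
  assumes "0 \<le> s" "s \<le> 3 - y"
  obtains "0 \<le> s" "s \<le> 1 - y" | "1 - y \<le> s" "s \<le> (1::real)" | "1 \<le> s" "s \<le> 2 - y"
    | "2 - y \<le> s" "s \<le> 2" | "2 \<le> s" "s \<le> 3 - y"
  using assms by linarith

text \<open>
  On each triangle the coordinates determine $(s, y)$ by linear equations. Two triangles that share
  vertices modulo 5 do so either within the strip, where both give the same $(s, y)$, or across its two
  ends, where the first edge meets the last one upside down. All 25 pairs of triangles are
  linear arithmetic.
\<close>
lemma strip_point_eq_iff:
  assumes y: "0 \<le> y" "y \<le> 1" "0 \<le> s" "s \<le> 3 - y"
    and y': "0 \<le> y'" "y' \<le> 1" "0 \<le> s'" "s' \<le> 3 - y'"
  shows "strip_point s y = strip_point s' y' \<longleftrightarrow>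
    s = s' \<and> y = y' \<or> s = 0 \<and> s' = 3 - y' \<and> y' = 1 - y \<or> s = 3 - y \<and> s' = 0 \<and> y' = 1 - y"
    (is "_ \<longleftrightarrow> ?R")
proof
  note cell = strip_point_cell[OF y(1,2)] strip_point_cell[OF y'(1,2)]
  assume eq: "strip_point s y = strip_point s' y'"
  show ?R
    by (cases rule: strip_cases[OF y(3,4)]; cases rule: strip_cases[OF y'(3,4)];
        insert eq y y'; simp only: cell weights_eq_iff; smt (verit))
next
  assume ?R
  then show "strip_point s y = strip_point s' y'"
    using y y' by (auto simp: strip_point_cell(1,5) weights_eq_iff)
qed

lemma strip_point_image:
  "{strip_point s y | s y. 0 \<le> y \<and> y \<le> 1 \<and> 0 \<le> s \<and> s \<le> 3 - y} = band_points"
proof (intro equalityI subsetI)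
  fix f assume "f \<in> {strip_point s y | s y. 0 \<le> y \<and> y \<le> 1 \<and> 0 \<le> s \<and> s \<le> 3 - y}"
  then obtain s y where f: "f = strip_point s y" and y: "0 \<le> y" "y \<le> 1" "0 \<le> s" "s \<le> 3 - y"
    by blast
  from y(3,4) show "f \<in> band_points"
  proof (cases rule: strip_cases)
    case 1
    then show ?thesis using y by (simp add: f strip_point_cell band_points_weights)
  next
    case 2
    then show ?thesis using y by (simp add: f strip_point_cell band_points_weights)
  next
    case 3
    then show ?thesis using y by (simp add: f strip_point_cell band_points_weights)
  next
    case 4
    then show ?thesis using y by (simp add: f strip_point_cell band_points_weights)
  next
    case 5
    then show ?thesis using y by (simp add: f strip_point_cell band_points_weights)
  qed
next
  fix f assume "f \<in> band_points"
  then obtain a b c where abc: "0 \<le> a" "0 \<le> b" "0 \<le> c" "a + b + c = 1"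
    and f: "f \<in> {weights a b c 0 0, weights 0 a b c 0, weights 0 0 a b c,
          weights c 0 0 a b, weights b c 0 0 a}"
    by (auto simp: band_points_def)
  \<comment> \<open>The height is the total weight on the upper vertices 1, 3, 5; the position then follows from
    the weight of the last vertex, or of the first one, of the triangle.\<close>
  have *: "weights a b c 0 0 = strip_point c b"
    "weights 0 a b c 0 = strip_point (1 - a) (1 - b)"
    "weights 0 0 a b c = strip_point (1 + c) b"
    "weights c 0 0 a b = strip_point (2 - a) (1 - b)"
    "weights b c 0 0 a = strip_point (2 + c) b"
    using abc by (simp_all add: strip_point_cell weights_eq_iff)
  have strip: "strip_point s y \<in> {strip_point s y | s y. 0 \<le> y \<and> y \<le> 1 \<and> 0 \<le> s \<and> s \<le> 3 - y}"
    if "0 \<le> y" "y \<le> 1" "0 \<le> s" "s \<le> 3 - y" for s y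
    using that by blast
  show "f \<in> {strip_point s y | s y. 0 \<le> y \<and> y \<le> 1 \<and> 0 \<le> s \<and> s \<le> 3 - y}"
    using f abc unfolding * by (elim insertE emptyE; simp only:; intro strip; simp)
qed

lemma continuous_on_weights:
  assumes "continuous_on S a" "continuous_on S b" "continuous_on S c" "continuous_on S d" "continuous_on S e"
  shows "continuous_on S (\<lambda>z. weights (a z) (b z) (c z) (d z) (e z))"
proof (rule continuous_on_coordinatewise_then_product)
  fix i :: nat
  show "continuous_on S (\<lambda>z. weights (a z) (b z) (c z) (d z) (e z) i)"
    using assms
    by (cases "i = 4"; cases "i = 3"; cases "i = 2"; cases "i = 1"; cases "i = 0")
      (simp_all add: weights_def)
qed

text \<open>
  Rescaling each horizontal line by its length $3 - y$ turns the trapezoid into the unit square. The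
  identifications found for the strip become those of the Moebius band.
\<close>
lemma band_complex_1_homeomorphic_moebius_band:
  "underlying_space (band_complex 1) homeomorphic_space moebius_band"
proof -
  define g where "g = (\<lambda>(x, y). strip_point ((3 - y) * x) y)"
  have strip: "0 \<le> (3 - y) * x" "(3 - y) * x \<le> 3 - y" if "(x, y) \<in> unit_square" for x y
    using that by (auto simp: unit_square_def mult_left_le)
  have cont: "continuous_on unit_square g"
    unfolding g_def strip_point_def flow_def case_prod_beta
    by (intro continuous_on_weights continuous_intros)
  have compact: "compact unit_square"
    by (simp add: unit_square_def compact_Times)
  have image: "g ` unit_square = band_points"
    unfolding strip_point_image[symmetric]
  proof (intro equalityI subsetI)
    fix f assume "f \<in> g ` unit_square"
    then obtain x y where xy: "(x, y) \<in> unit_square" "f = strip_point ((3 - y) * x) y"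
      by (auto simp: g_def)
    then have "0 \<le> y" "y \<le> 1" by (auto simp: unit_square_def)
    with strip[OF xy(1)] xy(2)
    show "f \<in> {strip_point s y | s y. 0 \<le> y \<and> y \<le> 1 \<and> 0 \<le> s \<and> s \<le> 3 - y}"
      by blast
  next
    fix f assume "f \<in> {strip_point s y | s y. 0 \<le> y \<and> y \<le> 1 \<and> 0 \<le> s \<and> s \<le> 3 - y}"
    then obtain s y where f: "f = strip_point s y" and y: "0 \<le> y" "y \<le> 1" "0 \<le> s" "s \<le> 3 - y"
      by blast
    then have "(s / (3 - y), y) \<in> unit_square" "g (s / (3 - y), y) = f"
      by (auto simp: unit_square_def g_def)
    then show "f \<in> g ` unit_square" by blast
  qed
  have fibres: "g u = g v \<longleftrightarrow> (u, v) \<in> moebius_rel"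
    if u: "u \<in> unit_square" and v: "v \<in> unit_square" for u v
  proof -
    obtain x y x' y' where uv: "u = (x, y)" "v = (x', y')" by (metis surj_pair)
    have y: "0 \<le> y" "y \<le> 1" "0 \<le> y'" "y' \<le> 1"
      using u v by (auto simp: uv unit_square_def)
    have scale: "(3 - y) * x = 0 \<longleftrightarrow> x = 0" "(3 - y') * x' = 0 \<longleftrightarrow> x' = 0"
      "(3 - y) * x = 3 - y \<longleftrightarrow> x = 1" "(3 - y') * x' = 3 - y' \<longleftrightarrow> x' = 1"
      "(3 - y) * x = (3 - y) * x' \<longleftrightarrow> x = x'"
      using y by auto
    have "g u = g v \<longleftrightarrow>
        (3 - y) * x = (3 - y') * x' \<and> y = y' \<or>
        (3 - y) * x = 0 \<and> (3 - y') * x' = 3 - y' \<and> y' = 1 - y \<or>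
        (3 - y) * x = 3 - y \<and> (3 - y') * x' = 0 \<and> y' = 1 - y"
      using strip_point_eq_iff[OF y(1,2) strip[OF u[unfolded uv]] y(3,4) strip[OF v[unfolded uv]]]
      by (simp add: uv g_def)
    also have "\<dots> \<longleftrightarrow> x = x' \<and> y = y' \<or> x = 0 \<and> x' = 1 \<and> y' = 1 - y \<or> x = 1 \<and> x' = 0 \<and> y' = 1 - y"
      using scale by metis
    also have "\<dots> \<longleftrightarrow> (u, v) \<in> moebius_rel"
      using u v by (auto simp: uv moebius_rel_def)
    finally show ?thesis .
  qed
  have "moebius_band homeomorphic_space top_of_set band_points"
    unfolding moebius_band_def
  proof (rule homeomorphic_space_quotient_topology)
    show "continuous_map (top_of_set unit_square) (top_of_set band_points) g"
      using cont image by (auto simp: continuous_map_in_subtopology)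
    show "compact_space (top_of_set unit_square)"
      using compact by (simp add: compact_space_subtopology)
    show "Hausdorff_space (top_of_set band_points)"
      by (simp add: Hausdorff_space_subtopology)
    show "equiv (topspace (top_of_set unit_square)) moebius_rel"
      by (simp add: equiv_moebius_rel)
    show "g ` topspace (top_of_set unit_square) = topspace (top_of_set band_points)"
      by (simp add: image)
    show "g u = g v \<longleftrightarrow> (u, v) \<in> moebius_rel"
      if "u \<in> topspace (top_of_set unit_square)" "v \<in> topspace (top_of_set unit_square)" for u v
      using that by (simp add: fibres)
  qed
  then show ?thesis
    unfolding underlying_space_band_complex_1 by (rule homeomorphic_space_sym[THEN iffD1])
qed

lemma triangulated_moebius_band_complexes:
  "triangulated_moebius_band (band_complex 1)" "triangulated_moebius_band (band_complex 2)"
proof -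
  have "underlying_space (band_complex 2) homeomorphic_space moebius_band"
    using underlying_space_relabel[OF bij_double_mod_5, of "band_complex 1"]
      band_complex_1_homeomorphic_moebius_band
    unfolding double_mod_5_band_complex by (rule homeomorphic_space_trans)
  then show "triangulated_moebius_band (band_complex 1)" "triangulated_moebius_band (band_complex 2)"
    using band_complex_1_homeomorphic_moebius_band
    by (simp_all only: triangulated_moebius_band_def abstract_band_complex two_dimensional_band_complex)
qed


section \<open>The decomposition of the 2-skeleton\<close>

theorem corollary4:
  shows "\<exists>K L :: nat set set.
    triangulated_moebius_band K \<and> triangulated_moebius_band L \<and>
    K \<union> L = skeleton 2 (full_simplex {0..4}) \<and>
    triangles K \<inter> triangles L = {} \<and>
    (\<forall>p. schlegel_diagram {0..4} p \<longrightarrow>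
       realized_geometrically p K \<and> realized_geometrically p L \<and>
       geometric_moebius_band (geometric_complex p K) \<and>
       geometric_moebius_band (geometric_complex p L) \<and>
       geometric_1_skeleton (geometric_complex p K) =
         geometric_1_skeleton (geometric_complex p L) \<and>
       geometric_faces (geometric_complex p K) \<inter> geometric_faces (geometric_complex p L) = {})"
proof (intro exI conjI allI impI)
  let ?K = "band_complex 1" and ?L = "band_complex 2"
  note sub = band_complex_subset_skeleton
  note share = band_complexes_share_edges and split = band_complexes_split_triangles
  show K: "triangulated_moebius_band ?K" and L: "triangulated_moebius_band ?L"
    by (fact triangulated_moebius_band_complexes)+
  show "?K \<union> ?L = skeleton 2 (full_simplex {0..4})"
  proof
    show "skeleton 2 (full_simplex {0..4}) \<subseteq> ?K \<union> ?L"
    proof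
      fix \<sigma> assume "\<sigma> \<in> skeleton 2 (full_simplex {0..4::nat})"
      then have "\<sigma> \<in> full_simplex {0..4}" "card \<sigma> \<le> 2 \<or> card \<sigma> = 3"
        by (auto simp: skeleton_def)
      then show "\<sigma> \<in> ?K \<union> ?L"
        using share split by blast
    qed
  qed (use sub in blast)
  show disjoint: "triangles ?K \<inter> triangles ?L = {}"
    using split sub unfolding triangles_def skeleton_def by blast
  fix p :: "nat \<Rightarrow> real^3" assume S: "schlegel_diagram {0..4} p"
  show RK: "realized_geometrically p ?K" and RL: "realized_geometrically p ?L"
    by (rule schlegel_diagram_realizes_2_skeleton[OF S sub])+
  show "geometric_moebius_band (geometric_complex p ?K)"
    "geometric_moebius_band (geometric_complex p ?L)"
    unfolding geometric_moebius_band_def using K L RK RL by blast+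
  have "skeleton 1 (band_complex d) = {\<sigma> \<in> full_simplex {0..4}. card \<sigma> \<le> 2}" if "d \<in> {1, 2}" for d
  proof -
    have "\<sigma> \<in> band_complex d" if "\<sigma> \<in> full_simplex {0..4}" "card \<sigma> \<le> 2" for \<sigma>
      using share[OF that] \<open>d \<in> {1, 2}\<close> by blast
    then show ?thesis
      using sub[of d] by (auto simp: skeleton_def)
  qed
  then have "skeleton 1 ?K = skeleton 1 ?L"
    by blast
  then show "geometric_1_skeleton (geometric_complex p ?K) = geometric_1_skeleton (geometric_complex p ?L)"
    by (simp only: schlegel_geometric_1_skeleton[OF S sub])
  have "geometric_complex p (triangles ?K) \<inter> geometric_complex p (triangles ?L) =
      geometric_complex p (triangles ?K \<inter> triangles ?L)"
    unfolding geometric_complex_def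
    by (rule inj_on_image_Int[OF schlegel_convex_hull_inj_on[OF S], symmetric])
      (use sub in \<open>auto simp: triangles_def\<close>)
  then show "geometric_faces (geometric_complex p ?K) \<inter> geometric_faces (geometric_complex p ?L) = {}"
    by (simp only: schlegel_geometric_faces[OF S sub] disjoint) (simp add: geometric_complex_def)
qed

end
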